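(* Let $G$ be a bi-directed graph and let $G^{\min}$ be a minimally oriented graph of $G$. If $G$ is Markov equivalent to an undirected graph $U$, then $G^{\min}=U$, and this is the unique minimally oriented graph of $G$.
   Context: A simple mixed graph $G=(V,E)$ has a finite vertex set $V$ and at most one edge between any two distinct vertices (no loops), each edge being undirected ($v-w$), directed ($v\to w$ or $v\leftarrow w$), or bi-directed ($v\leftrightarrow w$). An edge $v\leftarrow w$ or $v\leftrightarrow w$ has an arrowhead at $v$; an edge $v\to w$ or $v-w$ has a tail at $v$. A bi-directed (undirected, directed) graph has only bi-directed (undirected, directed) edges. Vertices are adjacent if joined by an edge of any type. A path is a sequence of distinct vertices with consecutive ones adjacent. $v$ is an ancestor of $w$ if $v=w$ or there is a directed path $v\to\cdots\to w$; $\mathrm{An}(C)$ is the set of ancestors of elements of $C$. Ancestral graph: a simple mixed graph such that (i) there are no directed cycles; (ii) if $v-w\in G$ then there is no $u$ with $u\to v\in G$ or $u\leftrightarrow v\in G$; (iii) if $v\leftrightarrow w\in G$ then $v$ is not an ancestor of $w$. (Bi-directed and undirected graphs are ancestral.) m-separation: a non-endpoint vertex on a path is a collider if both path edges at it have an arrowhead at it, otherwise a non-collider. A path between $v$ and $w$ is $m$-connecting given $C\subseteq V\setminus\{v,w\}$ if every non-collider on it is not in $C$ and every collider on it is in $\mathrm{An}(C)$. $v,w$ are $m$-separated given $C$ if no path $m$-connects them given $C$; disjoint non-empty sets $A,B$ are $m$-separated given $C\subseteq V\setminus(A\cup B)$ if every $v\in A$ and $w\in B$ are. An ancestral graph is maximal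 if for every pair of distinct non-adjacent vertices $v,w$ there is some $C\subseteq V\setminus\{v,w\}$ such that $v,w$ are $m$-separated given $C$. Two ancestral graphs on the same vertex set are Markov equivalent if they have the same $m$-separations (the same triples $(A,B,C)$ with $A,B$ $m$-separated given $C$). Minimally oriented graph of a bi-directed graph $G$: a graph $G^{\min}$ such that (i) $G^{\min}$ is a maximal ancestral graph; (ii) $G$ and $G^{\min}$ are Markov equivalent; (iii) $G^{\min}$ has the minimum number of arrowheads among all maximal ancestral graphs Markov equivalent to $G$, where the number of arrowheads of a graph with $d$ directed and $b$ bi-directed edges is $d+2b$. *)

theory Defs
  imports Main
begin

text \<open>
  Undirected and bi-directed edges between \<open>v\<close> and \<open>w\<close> are the two-element set \<open>{v, w}\<close>;
  the directed edge from \<open>v\<close> to \<open>w\<close> is the pair \<open>(v, w)\<close>. Each edge is thus represented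
  exactly once, so that equality of records is equality of graphs and edges can be counted
  by \<^const>\<open>card\<close>.
\<close>

record 'a mixed_graph =
  verts :: "'a set"
  undirected :: "'a set set"
  directed :: "('a \<times> 'a) set"
  bidirected :: "'a set set"

definition simple_mixed_graph :: "'a mixed_graph \<Rightarrow> bool" where
  "simple_mixed_graph G \<longleftrightarrow>
     finite (verts G) \<and>
     (\<forall>e \<in> undirected G \<union> bidirected G. \<exists>v \<in> verts G. \<exists>w \<in> verts G. v \<noteq> w \<and> e = {v, w}) \<and>
     (\<forall>(v, w) \<in> directed G. v \<in> verts G \<and> w \<in> verts G \<and> v \<noteq> w) \<and>
     undirected G \<inter> bidirected G = {} \<and>
     (\<forall>(v, w) \<in> directed G.
        (w, v) \<notin> directed G \<and> {v, w} \<notin> undirected G \<and> {v, w} \<notin> bidirected G)"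

definition bidirected_graph :: "'a mixed_graph \<Rightarrow> bool" where
  "bidirected_graph G \<longleftrightarrow> simple_mixed_graph G \<and> undirected G = {} \<and> directed G = {}"

definition undirected_graph :: "'a mixed_graph \<Rightarrow> bool" where
  "undirected_graph G \<longleftrightarrow> simple_mixed_graph G \<and> directed G = {} \<and> bidirected G = {}"

definition adjacent :: "'a mixed_graph \<Rightarrow> 'a \<Rightarrow> 'a \<Rightarrow> bool" where
  "adjacent G v w \<longleftrightarrow>
     {v, w} \<in> undirected G \<or> (v, w) \<in> directed G \<or> (w, v) \<in> directed G \<or> {v, w} \<in> bidirected G"

text \<open>\<open>arrowhead_at G v w\<close>: the edge between \<open>v\<close> and \<open>w\<close> has an arrowhead at \<open>v\<close>.\<close>

definition arrowhead_at :: "'a mixed_graph \<Rightarrow> 'a \<Rightarrow> 'a \<Rightarrow> bool" where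
  "arrowhead_at G v w \<longleftrightarrow> (w, v) \<in> directed G \<or> {v, w} \<in> bidirected G"

text \<open>In a simple graph the vertex sequence of a path determines its edges.\<close>

definition is_path :: "'a mixed_graph \<Rightarrow> 'a \<Rightarrow> 'a list \<Rightarrow> 'a \<Rightarrow> bool" where
  "is_path G v p w \<longleftrightarrow>
     p \<noteq> [] \<and> hd p = v \<and> last p = w \<and> distinct p \<and> set p \<subseteq> verts G \<and> successively (adjacent G) p"

definition directed_path :: "'a mixed_graph \<Rightarrow> 'a \<Rightarrow> 'a list \<Rightarrow> 'a \<Rightarrow> bool" where
  "directed_path G v p w \<longleftrightarrow>
     is_path G v p w \<and> successively (\<lambda>x y. (x, y) \<in> directed G) p"

definition ancestor :: "'a mixed_graph \<Rightarrow> 'a \<Rightarrow> 'a \<Rightarrow> bool" where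
  "ancestor G v w \<longleftrightarrow> v = w \<or> (\<exists>p. directed_path G v p w)"

definition An :: "'a mixed_graph \<Rightarrow> 'a set \<Rightarrow> 'a set" where
  "An G C = {v \<in> verts G. \<exists>w \<in> C. ancestor G v w}"

definition ancestral :: "'a mixed_graph \<Rightarrow> bool" where
  "ancestral G \<longleftrightarrow>
     simple_mixed_graph G \<and>
     acyclic (directed G) \<and>
     (\<forall>v w. {v, w} \<in> undirected G \<longrightarrow> \<not> (\<exists>u. (u, v) \<in> directed G \<or> {u, v} \<in> bidirected G)) \<and>
     (\<forall>v w. {v, w} \<in> bidirected G \<longrightarrow> \<not> ancestor G v w)"

text \<open>\<open>collider G p i\<close> is only meant for inner positions \<open>0 < i < length p - 1\<close>.\<close>

definition collider :: "'a mixed_graph \<Rightarrow> 'a list \<Rightarrow> nat \<Rightarrow> bool" where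
  "collider G p i \<longleftrightarrow>
     arrowhead_at G (p ! i) (p ! (i - 1)) \<and> arrowhead_at G (p ! i) (p ! (i + 1))"

definition m_connecting :: "'a mixed_graph \<Rightarrow> 'a \<Rightarrow> 'a list \<Rightarrow> 'a \<Rightarrow> 'a set \<Rightarrow> bool" where
  "m_connecting G v p w C \<longleftrightarrow>
     is_path G v p w \<and>
     (\<forall>i. 0 < i \<and> i + 1 < length p \<longrightarrow>
        (\<not> collider G p i \<longrightarrow> p ! i \<notin> C) \<and> (collider G p i \<longrightarrow> p ! i \<in> An G C))"

definition vertices_m_separated :: "'a mixed_graph \<Rightarrow> 'a \<Rightarrow> 'a \<Rightarrow> 'a set \<Rightarrow> bool" where
  "vertices_m_separated G v w C \<longleftrightarrow> \<not> (\<exists>p. m_connecting G v p w C)"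

definition m_separated :: "'a mixed_graph \<Rightarrow> 'a set \<Rightarrow> 'a set \<Rightarrow> 'a set \<Rightarrow> bool" where
  "m_separated G A B C \<longleftrightarrow>
     A \<noteq> {} \<and> B \<noteq> {} \<and> A \<subseteq> verts G \<and> B \<subseteq> verts G \<and> A \<inter> B = {} \<and> C \<subseteq> verts G - (A \<union> B) \<and>
     (\<forall>v \<in> A. \<forall>w \<in> B. vertices_m_separated G v w C)"

definition maximal_ancestral :: "'a mixed_graph \<Rightarrow> bool" where
  "maximal_ancestral G \<longleftrightarrow>
     ancestral G \<and>
     (\<forall>v \<in> verts G. \<forall>w \<in> verts G. v \<noteq> w \<and> \<not> adjacent G v w \<longrightarrow>
        (\<exists>C \<subseteq> verts G - {v, w}. vertices_m_separated G v w C))"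

definition Markov_equivalent :: "'a mixed_graph \<Rightarrow> 'a mixed_graph \<Rightarrow> bool" where
  "Markov_equivalent G H \<longleftrightarrow>
     ancestral G \<and> ancestral H \<and> verts G = verts H \<and>
     (\<forall>A B C. m_separated G A B C \<longleftrightarrow> m_separated H A B C)"

definition num_arrowheads :: "'a mixed_graph \<Rightarrow> nat" where
  "num_arrowheads G = card (directed G) + 2 * card (bidirected G)"

definition minimally_oriented :: "'a mixed_graph \<Rightarrow> 'a mixed_graph \<Rightarrow> bool" where
  "minimally_oriented G H \<longleftrightarrow>
     maximal_ancestral H \<and>
     Markov_equivalent G H \<and>
     (\<forall>H'. maximal_ancestral H' \<and> Markov_equivalent G H' \<longrightarrow> num_arrowheads H \<le> num_arrowheads H')"

lemma bidirected_graph_ancestral: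
  assumes "bidirected_graph G"
  shows "ancestral G"
proof -
  have simple: "simple_mixed_graph G" and und: "undirected G = {}" and dir: "directed G = {}"
    using assms by (auto simp: bidirected_graph_def)
  have "\<not> ancestor G v w" if e: "{v, w} \<in> bidirected G" for v w
  proof
    assume a: "ancestor G v w"
    obtain x y where "x \<noteq> y" "{v, w} = {x, y}"
      using simple e unfolding simple_mixed_graph_def by blast
    then have "v \<noteq> w" by auto
    with a obtain p where "directed_path G v p w"
      by (auto simp: ancestor_def)
    then show False
      using \<open>v \<noteq> w\<close> dir
      by (cases p rule: remdups_adj.cases) (auto simp: directed_path_def is_path_def)
  qed
  with simple und dir show ?thesis
    by (simp add: ancestral_def acyclic_def)
qed

lemma undirected_graph_ancestral: "undirected_graph G \<Longrightarrow> ancestral G"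
  by (simp add: undirected_graph_def ancestral_def acyclic_def)

end

theory Submission
  imports Defs
begin

text \<open>
  An undirected graph has no arrowheads and is maximal, since non-adjacent \<open>v\<close> and \<open>w\<close> are
  separated by all the remaining vertices. Hence \<open>U\<close> attains the minimum, and every minimally
  oriented graph of \<open>G\<close> is undirected too. The same separating sets allow the edges of an
  undirected graph to be read off its \<open>m\<close>-separations.
\<close>

text \<open>The edge itself is a path without inner vertices, so it is \<open>m_connecting\<close>
  whatever \<open>C\<close> is.\<close>

lemma adjacent_not_separated:
  assumes "v \<in> verts G" "w \<in> verts G" "v \<noteq> w" "adjacent G v w"
  shows "\<not> vertices_m_separated G v w C"
proof -
  have "m_connecting G v [v, w] w C"
    using assms by (simp add: m_connecting_def is_path_def)
  then show ?thesis
    by (auto simp: vertices_m_separated_def)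
qed

text \<open>A path between distinct non-adjacent vertices has an inner vertex. Without arrowheads
  that vertex is a non-collider, and it lies in the conditioning set, so it blocks the path.\<close>

lemma undirected_separated_by_rest:
  assumes U: "undirected_graph U" and "v \<noteq> w" and nadj: "\<not> adjacent U v w"
  shows "vertices_m_separated U v w (verts U - {v, w})"
  unfolding vertices_m_separated_def
proof
  assume "\<exists>p. m_connecting U v p w (verts U - {v, w})"
  then obtain p where path: "is_path U v p w"
    and noncol: "\<And>i. 0 < i \<Longrightarrow> i + 1 < length p \<Longrightarrow> \<not> collider U p i
      \<Longrightarrow> p ! i \<notin> verts U - {v, w}"
    unfolding m_connecting_def by blast
  \<comment> \<open>This needs no bound on the length of \<open>p\<close>, since no edge of
    \<open>U\<close> has an arrowhead.\<close>
  have "\<not> collider U p 1"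
    using U by (simp add: collider_def arrowhead_at_def undirected_graph_def)
  \<comment> \<open>With at most two vertices, \<open>p\<close> would contradict
    \<open>v \<noteq> w\<close> or non-adjacency; otherwise position 1 is an inner one.\<close>
  consider "p = []" | a where "p = [a]" | a b where "p = [a, b]" | a b c q where "p = a # b # c # q"
    by (metis neq_Nil_conv)
  then show False
  proof cases
    case (4 a b c q)
    then have "b \<in> verts U - {v, w}"
      using path by (auto simp: is_path_def split: if_splits)
    with noncol[of 1] \<open>\<not> collider U p 1\<close> 4 show False
      by simp
  qed (use path \<open>v \<noteq> w\<close> nadj in \<open>auto simp: is_path_def\<close>)
qed

lemma undirected_graph_maximal_ancestral:
  assumes "undirected_graph U"
  shows "maximal_ancestral U"
  unfolding maximal_ancestral_def
  using undirected_graph_ancestral[OF assms] undirected_separated_by_rest[OF assms] by blast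

text \<open>The right-hand side mentions \<open>U\<close> only through \<open>verts\<close> and
  \<open>m_separated\<close>, the data shared by Markov equivalent graphs, so rewriting with it
  transfers edges from one graph to another.\<close>

lemma undirected_edge_iff:
  assumes U: "undirected_graph U"
  shows "e \<in> undirected U \<longleftrightarrow> (\<exists>v \<in> verts U. \<exists>w \<in> verts U. v \<noteq> w \<and> e = {v, w} \<and>
    \<not> m_separated U {v} {w} (verts U - {v, w}))"
proof -
  have adj: "adjacent U v w \<longleftrightarrow> {v, w} \<in> undirected U" for v w
    using U by (simp add: adjacent_def undirected_graph_def)
  have sep: "m_separated U {v} {w} (verts U - {v, w}) \<longleftrightarrow> {v, w} \<notin> undirected U"
    if "v \<in> verts U" "w \<in> verts U" "v \<noteq> w" for v w
    using adjacent_not_separated[of v U w] undirected_separated_by_rest[OF U, of v w] that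
    by (auto simp: m_separated_def adj)
  have "\<exists>v \<in> verts U. \<exists>w \<in> verts U. v \<noteq> w \<and> e = {v, w}" if "e \<in> undirected U"
    using U that unfolding undirected_graph_def simple_mixed_graph_def by blast
  with sep show ?thesis
    by blast
qed

lemma undirected_Markov_equivalent_eq:
  fixes U W :: "'a mixed_graph"
  assumes "undirected_graph U" "undirected_graph W" "Markov_equivalent U W"
  shows "U = W"
proof -
  have "verts U = verts W" "\<And>A B C. m_separated U A B C = m_separated W A B C"
    using assms(3) by (simp_all add: Markov_equivalent_def)
  then have "undirected U = undirected W"
    by (intro set_eqI)
      (simp only: undirected_edge_iff[OF assms(1)] undirected_edge_iff[OF assms(2)])
  with assms show ?thesis
    by (intro mixed_graph.equality) (auto simp: undirected_graph_def Markov_equivalent_def)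
qed

text \<open>Since \<open>card\<close> is also 0 on infinite sets, the edge sets must first be shown
  finite; this follows from finiteness of \<open>verts G\<close>.\<close>

lemma num_arrowheads_eq_0_iff:
  assumes G: "simple_mixed_graph G"
  shows "num_arrowheads G = 0 \<longleftrightarrow> undirected_graph G"
proof -
  have fin: "finite (verts G)"
    using G by (simp add: simple_mixed_graph_def)
  have "directed G \<subseteq> verts G \<times> verts G"
    using G by (auto simp: simple_mixed_graph_def)
  then have "finite (directed G)"
    using fin by (meson finite_SigmaI finite_subset)
  moreover have "e \<subseteq> verts G" if "e \<in> bidirected G" for e
  proof -
    have "\<exists>v \<in> verts G. \<exists>w \<in> verts G. v \<noteq> w \<and> e = {v, w}"
      using G that by (simp add: simple_mixed_graph_def)
    then show ?thesis
      by auto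
  qed
  then have "bidirected G \<subseteq> Pow (verts G)"
    by blast
  then have "finite (bidirected G)"
    using fin by (meson finite_Pow_iff finite_subset)
  ultimately show ?thesis
    using G by (simp add: num_arrowheads_def undirected_graph_def)
qed

theorem corollary18:
  fixes G Gmin U :: "'a mixed_graph"
  assumes "bidirected_graph G"
    and "minimally_oriented G Gmin"
    and "undirected_graph U"
    and "Markov_equivalent G U"
  shows "Gmin = U \<and> (\<forall>H. minimally_oriented G H \<longleftrightarrow> H = U)"
proof -
  have U0: "num_arrowheads U = 0"
    using assms(3) num_arrowheads_eq_0_iff by (auto simp: undirected_graph_def)
  have Umax: "maximal_ancestral U"
    using assms(3) by (rule undirected_graph_maximal_ancestral)
  have "H = U" if H: "minimally_oriented G H" for H
  proof -
    \<comment> \<open>\<open>U\<close> is itself a competitor in the minimality of \<open>H\<close>,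
      which bounds the count for \<open>H\<close> by 0.\<close>
    have "num_arrowheads H = 0" and "simple_mixed_graph H"
      using H U0 Umax assms(4)
      by (auto simp: minimally_oriented_def maximal_ancestral_def ancestral_def)
    then have "undirected_graph H"
      by (simp add: num_arrowheads_eq_0_iff)
    moreover have "Markov_equivalent H U"
      using H assms(4) by (simp add: minimally_oriented_def Markov_equivalent_def)
    ultimately show ?thesis
      using assms(3) undirected_Markov_equivalent_eq by blast
  qed
  moreover have "minimally_oriented G U"
    using Umax assms(4) U0 by (simp add: minimally_oriented_def)
  ultimately show ?thesis
    using assms(2) by blast
qed

end
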